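(* Let $(\Gamma_1,u)$ and $(\Gamma_2,v)$ be finitely generated discrete quantum groups. If $(\Gamma_1,u)$ is a quotient of $(\Gamma_2,v)$, i.e. $\Gamma_2\twoheadrightarrow\Gamma_1$, then $$m_k(\Gamma_2,v)\le m_k(\Gamma_1,u)$$ for all natural numbers $k$. In addition, if $m_k(\Gamma_2,v)=m_k(\Gamma_1,u)$ for all $k\in\mathbb{N}$, then $(\Gamma_1,u)$ and $(\Gamma_2,v)$ are isomorphic.
   Context: An (algebraic) compact quantum group $\mathbb{G}$ is a Hopf $*$-algebra $\mathrm{Pol}(\mathbb{G})$ over $\mathbb{C}$ with comultiplication $\Delta$ which admits a unital positive linear functional $h:\mathrm{Pol}(\mathbb{G})\to\mathbb{C}$ (the Haar state; it is unique and faithful) with $(h\otimes\mathrm{id})\Delta=h(\cdot)1=(\mathrm{id}\otimes h)\Delta$. It is a compact matrix quantum group with fundamental representation $u=(u_{ij})_{i,j=1}^n\in M_n(\mathrm{Pol}(\mathbb{G}))$ if $u$ is unitary, $\Delta(u_{ij})=\sum_{k=1}^n u_{ik}\otimes u_{kj}$ for all $i,j$, the entries $u_{ij}$ generate $\mathrm{Pol}(\mathbb{G})$ as a unital $*$-algebra, and $u^c=(u_{ij}^* )_{i,j=1}^n$ is invertible in $M_n(\mathrm{Pol}(\mathbb{G}))$. A finitely generated discrete quantum group $(\Gamma,u)$ (with $n^2$ generators) is by definition the Pontryagin dual of a compact matrix quantum group $\mathbb{G}$ with fundamental representation $u\in M_n(\mathrm{Pol}(\mathbb{G}))$; all data about $(\Gamma,u)$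 are expressed in terms of $(\mathrm{Pol}(\mathbb{G}),\Delta,u)$. For $(\Gamma_1,u)$, $(\Gamma_2,v)$ with duals $\mathbb{G}_1,\mathbb{G}_2$ and fundamental representations $u\in M_n(\mathrm{Pol}(\mathbb{G}_1))$, $v\in M_n(\mathrm{Pol}(\mathbb{G}_2))$ of the same size $n$, one says that $(\Gamma_1,u)$ is a quotient of $(\Gamma_2,v)$, written $\Gamma_2\twoheadrightarrow\Gamma_1$, if there is a $*$-homomorphism $\phi:\mathrm{Pol}(\mathbb{G}_2)\to\mathrm{Pol}(\mathbb{G}_1)$ with $\phi(v_{ij})=u_{ij}$ for all $i,j$. They are isomorphic if there is such a $\phi$ that is bijective. The main character is $\chi_{\Gamma,u}=\sum_{i=1}^n u_{ii}$ and the moments are $m_k(\Gamma,u)=h\big((\chi_{\Gamma,u}+\chi_{\Gamma,u}^* )^k\big)$, where $h$ is the Haar state of $\mathbb{G}$. *)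

theory Defs
  imports "HOL-Analysis.Analysis" "HOL-Library.Poly_Mapping" "HOL-Library.Complex_Order"
begin

section \<open>Complex vector spaces, algebras and *-algebras\<close>

class complex_vector = ab_group_add +
  fixes scaleC :: "complex \<Rightarrow> 'a \<Rightarrow> 'a" (infixr \<open>*\<^sub>C\<close> 75)
  assumes scaleC_add_right: "a *\<^sub>C (x + y) = a *\<^sub>C x + a *\<^sub>C y"
    and scaleC_add_left: "(a + b) *\<^sub>C x = a *\<^sub>C x + b *\<^sub>C x"
    and scaleC_scaleC: "a *\<^sub>C b *\<^sub>C x = (a * b) *\<^sub>C x"
    and scaleC_one: "1 *\<^sub>C x = x"

class complex_algebra_1 = complex_vector + ring_1 +
  assumes mult_scaleC_left: "(a *\<^sub>C x) * y = a *\<^sub>C (x * y)"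
    and mult_scaleC_right: "x * (a *\<^sub>C y) = a *\<^sub>C (x * y)"

class complex_star_algebra = complex_algebra_1 +
  fixes star :: "'a \<Rightarrow> 'a"
  assumes star_add: "star (x + y) = star x + star y"
    and star_scaleC: "star (a *\<^sub>C x) = cnj a *\<^sub>C star x"
    and star_mult: "star (x * y) = star y * star x"
    and star_star: "star (star x) = x"

global_interpretation complex_vector:
  vector_space "scaleC :: complex \<Rightarrow> 'a \<Rightarrow> 'a::complex_vector"
  by unfold_locales (simp_all add: scaleC_add_right scaleC_add_left scaleC_scaleC scaleC_one)

global_interpretation complex_vector: vector_space_pair
  "scaleC :: complex \<Rightarrow> 'a \<Rightarrow> 'a::complex_vector"
  "scaleC :: complex \<Rightarrow> 'b \<Rightarrow> 'b::complex_vector"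
  ..

abbreviation clinear :: "('a::complex_vector \<Rightarrow> 'b::complex_vector) \<Rightarrow> bool"
  where "clinear \<equiv> Vector_Spaces.linear scaleC scaleC"

lemma clinear_iff:
  "clinear f \<longleftrightarrow> (\<forall>x y. f (x + y) = f x + f y) \<and> (\<forall>c x. f (c *\<^sub>C x) = c *\<^sub>C f x)"
  by (simp add: Vector_Spaces.linear_iff complex_vector.vector_space_axioms)

definition cbilinear :: "('a::complex_vector \<Rightarrow> 'b::complex_vector \<Rightarrow> 'c::complex_vector) \<Rightarrow> bool"
  where "cbilinear B \<longleftrightarrow> (\<forall>y. clinear (\<lambda>x. B x y)) \<and> (\<forall>x. clinear (B x))"

instantiation complex :: complex_star_algebra
begin

definition scaleC_complex :: "complex \<Rightarrow> complex \<Rightarrow> complex"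
  where "scaleC_complex = (*)"

definition star_complex :: "complex \<Rightarrow> complex"
  where "star_complex = cnj"

instance
  by standard (simp_all add: scaleC_complex_def star_complex_def algebra_simps)

end

instantiation poly_mapping :: (type, complex_vector) complex_vector
begin

definition scaleC_poly_mapping :: "complex \<Rightarrow> ('a \<Rightarrow>\<^sub>0 'b) \<Rightarrow> 'a \<Rightarrow>\<^sub>0 'b"
  where "scaleC_poly_mapping c = Poly_Mapping.map (scaleC c)"

lemma lookup_scaleC: "Poly_Mapping.lookup (c *\<^sub>C f) k = c *\<^sub>C Poly_Mapping.lookup f k"
  for f :: "'a \<Rightarrow>\<^sub>0 'b"
  by (simp add: scaleC_poly_mapping_def Poly_Mapping.map.rep_eq when_def)

instance
  by standard
    (auto intro!: poly_mapping_eqI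
      simp: lookup_scaleC lookup_add scaleC_add_right scaleC_add_left scaleC_scaleC scaleC_one)

end

section \<open>The algebraic tensor product over the complex numbers\<close>

definition tensor_relations ::
    "(('a::complex_vector \<times> 'b::complex_vector) \<Rightarrow>\<^sub>0 complex) set" where
  "tensor_relations =
     {Poly_Mapping.single (x + x', y) 1
        - (Poly_Mapping.single (x, y) 1 + Poly_Mapping.single (x', y) 1) | x x' y. True}
   \<union> {Poly_Mapping.single (x, y + y') 1
        - (Poly_Mapping.single (x, y) 1 + Poly_Mapping.single (x, y') 1) | x y y'. True}
   \<union> {Poly_Mapping.single (c *\<^sub>C x, y) 1 - c *\<^sub>C Poly_Mapping.single (x, y) 1 | c x y. True}
   \<union> {Poly_Mapping.single (x, c *\<^sub>C y) 1 - c *\<^sub>C Poly_Mapping.single (x, y) 1 | c x y. True}"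

definition tensor_equiv ::
    "(('a::complex_vector \<times> 'b::complex_vector) \<Rightarrow>\<^sub>0 complex) \<Rightarrow> (('a \<times> 'b) \<Rightarrow>\<^sub>0 complex) \<Rightarrow> bool"
  where "tensor_equiv f g \<longleftrightarrow> f - g \<in> complex_vector.span tensor_relations"

quotient_type (overloaded) ('a, 'b) tensor =
    "('a::complex_vector \<times> 'b::complex_vector) \<Rightarrow>\<^sub>0 complex" / tensor_equiv
proof (rule equivpI)
  show "reflp tensor_equiv"
    by (auto intro!: reflpI simp: tensor_equiv_def complex_vector.span_zero)
  show "symp tensor_equiv"
    unfolding tensor_equiv_def
    by (rule sympI) (drule complex_vector.span_neg, simp)
  show "transp tensor_equiv"
    unfolding tensor_equiv_def
    by (rule transpI) (drule (1) complex_vector.span_add, simp)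
qed

instantiation tensor :: (complex_vector, complex_vector) complex_vector
begin

lift_definition zero_tensor :: "('a, 'b) tensor" is 0 .

lift_definition plus_tensor :: "('a, 'b) tensor \<Rightarrow> ('a, 'b) tensor \<Rightarrow> ('a, 'b) tensor" is "(+)"
  unfolding tensor_equiv_def by (drule (1) complex_vector.span_add) (simp add: algebra_simps)

lift_definition uminus_tensor :: "('a, 'b) tensor \<Rightarrow> ('a, 'b) tensor" is uminus
  unfolding tensor_equiv_def by (drule complex_vector.span_neg) (simp add: algebra_simps)

lift_definition minus_tensor :: "('a, 'b) tensor \<Rightarrow> ('a, 'b) tensor \<Rightarrow> ('a, 'b) tensor" is "(-)"
  unfolding tensor_equiv_def by (drule (1) complex_vector.span_diff) (simp add: algebra_simps)

lift_definition scaleC_tensor :: "complex \<Rightarrow> ('a, 'b) tensor \<Rightarrow> ('a, 'b) tensor" is scaleC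
  unfolding tensor_equiv_def
  by (metis complex_vector.span_scale complex_vector.scale_right_diff_distrib)

instance
  by standard
    (transfer; simp add: tensor_equiv_def complex_vector.span_zero scaleC_add_right
       scaleC_add_left scaleC_scaleC scaleC_one algebra_simps)+

end

lift_definition tensor_elem :: "'a::complex_vector \<Rightarrow> 'b::complex_vector \<Rightarrow> ('a, 'b) tensor"
  (infixr \<open>\<otimes>\<close> 76) is "\<lambda>x y. Poly_Mapping.single (x, y) 1" .

lemma cbilinear_tensor_elem: "cbilinear (\<otimes>)"
  unfolding cbilinear_def clinear_iff
  by (intro conjI allI; transfer; unfold tensor_equiv_def; rule complex_vector.span_base;
      unfold tensor_relations_def; blast)

lemma tensor_induct [case_names elem add]:
  assumes elem: "\<And>x y. P (x \<otimes> y)" and add: "\<And>s t. P s \<Longrightarrow> P t \<Longrightarrow> P (s + t)"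
  shows "P t"
proof -
  have "P (abs_tensor f)" for f
  proof (induction f rule: update_induct)
    case const
    have "(0::'a) \<otimes> (0::'b) = 0 *\<^sub>C (0 \<otimes> 0)"
      using cbilinear_tensor_elem unfolding cbilinear_def clinear_iff
      by (metis complex_vector.scale_zero_left)
    then show ?case using elem[of 0 0] by (simp add: zero_tensor_def)
  next
    case (update f a b)
    obtain x y where a: "a = (x, y)" by fastforce
    have 1: "Poly_Mapping.update a b f = f + b *\<^sub>C Poly_Mapping.single a 1"
      using update.hyps
      by (auto intro!: poly_mapping_eqI
          simp: lookup_update lookup_add lookup_scaleC lookup_single when_def scaleC_complex_def
            in_keys_iff)
    have "abs_tensor (Poly_Mapping.update a b f) = abs_tensor f + b *\<^sub>C (x \<otimes> y)"
      unfolding 1 unfolding a tensor_elem.abs_eq scaleC_tensor.abs_eq plus_tensor.abs_eq ..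
    also have "b *\<^sub>C (x \<otimes> y) = (b *\<^sub>C x) \<otimes> y"
      using cbilinear_tensor_elem unfolding cbilinear_def clinear_iff by metis
    finally show ?case using update elem add by simp
  qed
  then show ?thesis by (metis Quotient3_abs_rep Quotient3_tensor)
qed

text \<open>
  With \<open>\<sigma>\<close> the identity this is the linear map \<open>x \<otimes> y \<mapsto> B x y\<close> induced by a bilinear \<open>B\<close>; with
  \<open>\<sigma> = cnj\<close> it is the antilinear map induced by a \<open>B\<close> that is antilinear in each argument.
\<close>

definition tensor_semilift ::
    "(complex \<Rightarrow> complex) \<Rightarrow> ('a::complex_vector \<Rightarrow> 'b::complex_vector \<Rightarrow> 'c::complex_vector)
      \<Rightarrow> ('a, 'b) tensor \<Rightarrow> 'c" where
  "tensor_semilift \<sigma> B t =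
     (\<Sum>p\<in>Poly_Mapping.keys (rep_tensor t).
        \<sigma> (Poly_Mapping.lookup (rep_tensor t) p) *\<^sub>C B (fst p) (snd p))"

definition tensor_lift ::
    "('a::complex_vector \<Rightarrow> 'b::complex_vector \<Rightarrow> 'c::complex_vector) \<Rightarrow> ('a, 'b) tensor \<Rightarrow> 'c"
  where "tensor_lift = tensor_semilift (\<lambda>c. c)"

lemma tensor_semilift:
  fixes B :: "'a::complex_vector \<Rightarrow> 'b::complex_vector \<Rightarrow> 'c::complex_vector"
  assumes \<sigma>: "\<And>c d. \<sigma> (c + d) = \<sigma> c + \<sigma> d" "\<And>c d. \<sigma> (c * d) = \<sigma> c * \<sigma> d" "\<sigma> 1 = 1"
    and B: "\<And>x x' y. B (x + x') y = B x y + B x' y" "\<And>x y y'. B x (y + y') = B x y + B x y'"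
      "\<And>c x y. B (c *\<^sub>C x) y = \<sigma> c *\<^sub>C B x y" "\<And>c x y. B x (c *\<^sub>C y) = \<sigma> c *\<^sub>C B x y"
  shows "tensor_semilift \<sigma> B (x \<otimes> y) = B x y"
    and "tensor_semilift \<sigma> B (s + t) = tensor_semilift \<sigma> B s + tensor_semilift \<sigma> B t"
    and "tensor_semilift \<sigma> B (c *\<^sub>C t) = \<sigma> c *\<^sub>C tensor_semilift \<sigma> B t"
proof -
  define L where "L f = (\<Sum>p\<in>Poly_Mapping.keys f.
      \<sigma> (Poly_Mapping.lookup f p) *\<^sub>C B (fst p) (snd p))" for f
  have \<sigma>0: "\<sigma> 0 = 0" using \<sigma>(1)[of 0 0] by simp
  have L_add: "L (f + g) = L f + L g" for f g
    unfolding L_def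
    by (rule setsum_keys_plus_distrib) (simp_all add: \<sigma> \<sigma>0 scaleC_add_left)
  have L_scale: "L (c *\<^sub>C f) = \<sigma> c *\<^sub>C L f" for c f
  proof -
    have "L (c *\<^sub>C f) = (\<Sum>p\<in>Poly_Mapping.keys f.
        \<sigma> (Poly_Mapping.lookup (c *\<^sub>C f) p) *\<^sub>C B (fst p) (snd p))"
      unfolding L_def
      by (rule sum.mono_neutral_left) (auto simp: in_keys_iff lookup_scaleC \<sigma>0)
    then show ?thesis
      by (simp add: L_def lookup_scaleC scaleC_complex_def \<sigma> complex_vector.scale_sum_right
          scaleC_scaleC)
  qed
  have L_single: "L (Poly_Mapping.single (x, y) 1) = B x y" for x y
    by (simp add: L_def \<sigma> scaleC_one)
  have \<sigma>m1: "\<sigma> (- 1) = - 1" using \<sigma>(1)[of 1 "- 1"] \<sigma>0 \<sigma>(3)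
    by (simp add: eq_neg_iff_add_eq_0 add.commute)
  have L_diff: "L (f - g) = L f - L g" for f g
    using L_add[of "f - g" g] by simp
  have L_null: "L f = 0" if "f \<in> complex_vector.span tensor_relations" for f
    using that
  proof (induction rule: complex_vector.span_induct)
    case base
    show ?case
      by (rule complex_vector.subspaceI)
        (simp_all add: L_add L_scale, simp add: L_def)
  next
    case (step f)
    then show ?case
      by (auto simp: tensor_relations_def L_diff L_add L_scale L_single B)
  qed
  have L_eq: "tensor_semilift \<sigma> B (abs_tensor f) = L f" for f
  proof -
    have "tensor_equiv (rep_tensor (abs_tensor f)) f"
      by (metis Quotient3_rep_abs Quotient3_tensor tensor.abs_eq_iff Quotient3_abs_rep)
    then have "L (rep_tensor (abs_tensor f)) - L f = 0"
      using L_null by (simp add: tensor_equiv_def flip: L_diff)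
    then show ?thesis by (simp add: tensor_semilift_def L_def)
  qed
  show "tensor_semilift \<sigma> B (x \<otimes> y) = B x y"
    by (simp add: tensor_elem.abs_eq L_eq L_single)
  obtain f where f: "s = abs_tensor f" by (metis Quotient3_abs_rep Quotient3_tensor)
  obtain g where g: "t = abs_tensor g" by (metis Quotient3_abs_rep Quotient3_tensor)
  show "tensor_semilift \<sigma> B (s + t) = tensor_semilift \<sigma> B s + tensor_semilift \<sigma> B t"
    by (simp add: f g plus_tensor.abs_eq L_eq L_add)
  show "tensor_semilift \<sigma> B (c *\<^sub>C t) = \<sigma> c *\<^sub>C tensor_semilift \<sigma> B t"
    by (simp add: g scaleC_tensor.abs_eq L_eq L_scale)
qed

lemma tensor_lift:
  assumes "cbilinear B"
  shows tensor_lift_elem: "tensor_lift B (x \<otimes> y) = B x y"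
    and tensor_lift_clinear: "clinear (tensor_lift B)"
  using assms unfolding cbilinear_def clinear_iff tensor_lift_def
  by (auto intro!: tensor_semilift[of "\<lambda>c. c" B])

lemma tensor_lift_unique:
  assumes "cbilinear B" "clinear f" "\<And>x y. f (x \<otimes> y) = B x y"
  shows "f = tensor_lift B"
proof
  fix t show "f t = tensor_lift B t"
    using assms tensor_lift[OF assms(1)]
    by (induction t rule: tensor_induct) (auto simp: clinear_iff)
qed

definition tensor_map ::
    "('a::complex_vector \<Rightarrow> 'c::complex_vector) \<Rightarrow> ('b::complex_vector \<Rightarrow> 'd::complex_vector)
      \<Rightarrow> ('a, 'b) tensor \<Rightarrow> ('c, 'd) tensor"
  where "tensor_map f g = tensor_lift (\<lambda>x y. f x \<otimes> g y)"

definition tensor_assoc ::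
    "(('a::complex_vector, 'b::complex_vector) tensor, 'c::complex_vector) tensor
      \<Rightarrow> ('a, ('b, 'c) tensor) tensor"
  where "tensor_assoc = tensor_lift (\<lambda>s z. tensor_lift (\<lambda>x y. x \<otimes> (y \<otimes> z)) s)"

text \<open>
  For a functional \<open>f\<close>, these are the maps \<open>f \<otimes> id\<close> and \<open>id \<otimes> f\<close> followed by the canonical
  identification of \<open>\<complex> \<otimes> B\<close> with \<open>B\<close> and of \<open>A \<otimes> \<complex>\<close> with \<open>A\<close>.
\<close>

definition slice_left ::
    "('a::complex_vector \<Rightarrow> complex) \<Rightarrow> ('a, 'b::complex_vector) tensor \<Rightarrow> 'b"
  where "slice_left f = tensor_lift (\<lambda>x y. f x *\<^sub>C y)"

definition slice_right ::
    "('b::complex_vector \<Rightarrow> complex) \<Rightarrow> ('a::complex_vector, 'b) tensor \<Rightarrow> 'a"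
  where "slice_right f = tensor_lift (\<lambda>x y. f y *\<^sub>C x)"

lemma tensor_elem_simps:
  "(x + x') \<otimes> y = x \<otimes> y + x' \<otimes> y" "x \<otimes> (y + y') = x \<otimes> y + x \<otimes> y'"
  "(c *\<^sub>C x) \<otimes> y = c *\<^sub>C (x \<otimes> y)" "x \<otimes> (c *\<^sub>C y) = c *\<^sub>C (x \<otimes> y)"
  using cbilinear_tensor_elem unfolding cbilinear_def clinear_iff by blast+

instantiation tensor :: (complex_algebra_1, complex_algebra_1) complex_algebra_1
begin

definition one_tensor :: "('a, 'b) tensor"
  where "1 = 1 \<otimes> 1"

definition times_tensor :: "('a, 'b) tensor \<Rightarrow> ('a, 'b) tensor \<Rightarrow> ('a, 'b) tensor"
  where "s * t = tensor_lift (\<lambda>x y. tensor_lift (\<lambda>x' y'. (x * x') \<otimes> (y * y')) t) s"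

lemma cbilinear_times_inner:
  "cbilinear (\<lambda>x' y'. ((x::'a) * x') \<otimes> ((y::'b) * y'))"
  unfolding cbilinear_def clinear_iff
  by (simp add: tensor_elem_simps distrib_left mult_scaleC_right)

lemma cbilinear_times_outer:
  "cbilinear (\<lambda>(x::'a) (y::'b). tensor_lift (\<lambda>x' y'. (x * x') \<otimes> (y * y')) t)"
  unfolding cbilinear_def clinear_iff
proof (intro conjI allI)
  note lin = tensor_lift_clinear[OF cbilinear_times_inner, unfolded clinear_iff]
  note el = tensor_lift_elem[OF cbilinear_times_inner]
  note alg = tensor_elem_simps distrib_right mult_scaleC_left scaleC_add_right
  fix x x' :: 'a and y y' :: 'b and c :: complex
  let ?T = "\<lambda>x y. tensor_lift (\<lambda>x' y'. (x * x') \<otimes> (y * y')) t"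
  show "?T (x + x') y = ?T x y + ?T x' y"
    by (induction t rule: tensor_induct) ((simp only: lin el)?, simp add: alg)+
  show "?T x (y + y') = ?T x y + ?T x y'"
    by (induction t rule: tensor_induct) ((simp only: lin el)?, simp add: alg)+
  show "?T (c *\<^sub>C x) y = c *\<^sub>C ?T x y"
    by (induction t rule: tensor_induct) ((simp only: lin el)?, simp add: alg)+
  show "?T x (c *\<^sub>C y) = c *\<^sub>C ?T x y"
    by (induction t rule: tensor_induct) ((simp only: lin el)?, simp add: alg)+
qed

lemma tensor_mult_elem: "(x \<otimes> y) * (x' \<otimes> y') = (x * x') \<otimes> ((y::'b) * y')" for x x' :: 'a
  unfolding times_tensor_def
  by (subst tensor_lift_elem[OF cbilinear_times_outer], rule tensor_lift_elem[OF cbilinear_times_inner])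

lemma tensor_mult_linear:
  fixes s t r :: "('a, 'b) tensor"
  shows "(s + r) * t = s * t + r * t" "(c *\<^sub>C s) * t = c *\<^sub>C (s * t)"
    "s * (t + r) = s * t + s * r" "s * (c *\<^sub>C t) = c *\<^sub>C (s * t)"
proof -
  note lin = tensor_lift_clinear[OF cbilinear_times_outer, unfolded clinear_iff]
  note lin' = tensor_lift_clinear[OF cbilinear_times_inner, unfolded clinear_iff]
  note el = tensor_lift_elem[OF cbilinear_times_outer]
  show l: "(s + r) * t = s * t + r * t" "(c *\<^sub>C s) * t = c *\<^sub>C (s * t)"
    for s t r :: "('a, 'b) tensor"
    by (simp_all only: times_tensor_def lin)
  show "s * (t + r) = s * t + s * r"
  proof (induction s rule: tensor_induct)
    case (elem x y)
    show ?case unfolding times_tensor_def el by (simp only: lin')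
  qed (simp add: l)
  show "s * (c *\<^sub>C t) = c *\<^sub>C (s * t)"
  proof (induction s rule: tensor_induct)
    case (elem x y)
    show ?case unfolding times_tensor_def el by (simp only: lin')
  qed (simp add: l scaleC_add_right)
qed

lemma unit_functional_exists: "\<exists>f :: 'c::complex_algebra_1 \<Rightarrow> complex. clinear f \<and> f 1 = 1"
proof -
  have ind: "complex_vector.independent {1::'c}"
    by (simp add: complex_vector.dependent_single)
  show ?thesis
    using complex_vector.linear_independent_extend[OF ind, of "\<lambda>_. 1::complex"] by auto
qed

instance
proof
  fix a b c :: "('a, 'b) tensor" and k :: complex
  show "a * b * c = a * (b * c)"
  proof (induction a rule: tensor_induct)
    case (elem x y)
    show ?case
    proof (induction b rule: tensor_induct)
      case (elem x' y')
      show ?case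
        by (induction c rule: tensor_induct)
          (simp_all add: tensor_mult_elem tensor_mult_linear mult.assoc)
    qed (simp add: tensor_mult_linear)
  qed (simp add: tensor_mult_linear)
  show "1 * a = a"
    by (induction a rule: tensor_induct)
      (simp_all add: one_tensor_def tensor_mult_elem tensor_mult_linear)
  show "a * 1 = a"
    by (induction a rule: tensor_induct)
      (simp_all add: one_tensor_def tensor_mult_elem tensor_mult_linear)
  show "(a + b) * c = a * c + b * c" "a * (b + c) = a * b + a * c"
    "k *\<^sub>C a * b = k *\<^sub>C (a * b)" "a * k *\<^sub>C b = k *\<^sub>C (a * b)"
    by (simp_all add: tensor_mult_linear)
  obtain f :: "'a \<Rightarrow> complex" where f: "clinear f" "f 1 = 1"
    using unit_functional_exists by blast
  obtain g :: "'b \<Rightarrow> complex" where g: "clinear g" "g 1 = 1"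
    using unit_functional_exists by blast
  have bil: "cbilinear (\<lambda>x y. f x * g y)"
    using f g unfolding cbilinear_def clinear_iff
    by (simp add: scaleC_complex_def algebra_simps)
  have "tensor_lift (\<lambda>x y. f x * g y) (1 \<otimes> 1) = 1"
    by (simp add: tensor_lift_elem[OF bil] f g)
  moreover have "tensor_lift (\<lambda>x y. f x * g y) 0 = 0"
    using tensor_lift_clinear[OF bil] by (rule complex_vector.linear_0)
  ultimately show "(0::('a, 'b) tensor) \<noteq> 1"
    unfolding one_tensor_def by (metis zero_neq_one)
qed

end

instantiation tensor :: (complex_star_algebra, complex_star_algebra) complex_star_algebra
begin

definition star_tensor :: "('a, 'b) tensor \<Rightarrow> ('a, 'b) tensor"
  where "star_tensor = tensor_semilift cnj (\<lambda>x y. star x \<otimes> star y)"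

lemma star_tensor_simps:
  fixes s t :: "('a, 'b) tensor"
  shows "star ((x::'a) \<otimes> (y::'b)) = star x \<otimes> star y" "star (s + t) = star s + star t"
    "star (c *\<^sub>C t) = cnj c *\<^sub>C star t"
  unfolding star_tensor_def
  by (rule tensor_semilift; simp add: star_add star_scaleC tensor_elem_simps)+

instance
proof
  fix s t :: "('a, 'b) tensor" and c :: complex
  show "star (s + t) = star s + star t" "star (c *\<^sub>C t) = cnj c *\<^sub>C star t"
    by (rule star_tensor_simps)+
  show "star (star s) = s"
    by (induction s rule: tensor_induct) (simp_all add: star_tensor_simps star_star)
  show "star (s * t) = star t * star s"
  proof (induction s rule: tensor_induct)
    case (elem x y)
    show ?case
      by (induction t rule: tensor_induct)
        (simp_all add: star_tensor_simps tensor_mult_elem star_mult distrib_left distrib_right)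
  qed (simp add: star_tensor_simps distrib_left distrib_right)
qed

end

section \<open>Compact quantum groups\<close>

definition star_hom :: "('a::complex_star_algebra \<Rightarrow> 'b::complex_star_algebra) \<Rightarrow> bool" where
  "star_hom \<phi> \<longleftrightarrow> clinear \<phi> \<and> (\<forall>x y. \<phi> (x * y) = \<phi> x * \<phi> y) \<and> \<phi> 1 = 1
     \<and> (\<forall>x. \<phi> (star x) = star (\<phi> x))"

text \<open>
  A compact quantum group is given by its comultiplication \<open>\<Delta>\<close>; the type \<open>'a\<close> plays the role of
  \<open>Pol(G)\<close>. The counit \<open>\<epsilon>\<close> and the antipode \<open>S\<close> are determined by \<open>\<Delta>\<close>, and so is the Haar state.
\<close>

definition is_counit ::
    "('a::complex_star_algebra \<Rightarrow> ('a, 'a) tensor) \<Rightarrow> ('a \<Rightarrow> complex) \<Rightarrow> bool" where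
  "is_counit \<Delta> \<epsilon> \<longleftrightarrow>
     clinear \<epsilon> \<and> (\<forall>x y. \<epsilon> (x * y) = \<epsilon> x * \<epsilon> y) \<and> \<epsilon> 1 = 1
     \<and> (\<forall>a. slice_left \<epsilon> (\<Delta> a) = a \<and> slice_right \<epsilon> (\<Delta> a) = a)"

definition is_antipode ::
    "('a::complex_star_algebra \<Rightarrow> ('a, 'a) tensor) \<Rightarrow> ('a \<Rightarrow> complex) \<Rightarrow> ('a \<Rightarrow> 'a) \<Rightarrow> bool" where
  "is_antipode \<Delta> \<epsilon> S \<longleftrightarrow>
     clinear S
     \<and> (\<forall>a. tensor_lift (*) (tensor_map S id (\<Delta> a)) = \<epsilon> a *\<^sub>C 1
          \<and> tensor_lift (*) (tensor_map id S (\<Delta> a)) = \<epsilon> a *\<^sub>C 1)"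

definition hopf_star_algebra :: "('a::complex_star_algebra \<Rightarrow> ('a, 'a) tensor) \<Rightarrow> bool" where
  "hopf_star_algebra \<Delta> \<longleftrightarrow>
     star_hom \<Delta>
     \<and> (\<forall>a. tensor_assoc (tensor_map \<Delta> id (\<Delta> a)) = tensor_map id \<Delta> (\<Delta> a))
     \<and> (\<exists>\<epsilon> S. is_counit \<Delta> \<epsilon> \<and> is_antipode \<Delta> \<epsilon> S)"

definition is_haar_state ::
    "('a::complex_star_algebra \<Rightarrow> ('a, 'a) tensor) \<Rightarrow> ('a \<Rightarrow> complex) \<Rightarrow> bool" where
  "is_haar_state \<Delta> h \<longleftrightarrow>
     clinear h \<and> h 1 = 1 \<and> (\<forall>a. 0 \<le> h (star a * a))
     \<and> (\<forall>a. slice_left h (\<Delta> a) = h a *\<^sub>C 1 \<and> slice_right h (\<Delta> a) = h a *\<^sub>C 1)"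

definition compact_quantum_group :: "('a::complex_star_algebra \<Rightarrow> ('a, 'a) tensor) \<Rightarrow> bool"
  where "compact_quantum_group \<Delta> \<longleftrightarrow> hopf_star_algebra \<Delta> \<and> (\<exists>h. is_haar_state \<Delta> h)"

definition haar_state :: "('a::complex_star_algebra \<Rightarrow> ('a, 'a) tensor) \<Rightarrow> 'a \<Rightarrow> complex"
  where "haar_state \<Delta> = (THE h. is_haar_state \<Delta> h)"

lemma is_haar_state_unique:
  assumes h: "is_haar_state \<Delta> h" and h': "is_haar_state \<Delta> h'"
  shows "h = h'"
proof
  fix a
  have lin: "clinear h" "clinear h'" and one: "h 1 = 1" "h' 1 = 1"
    using h h' by (auto simp: is_haar_state_def)
  have bl: "cbilinear (\<lambda>x y. h x *\<^sub>C y)" and br: "cbilinear (\<lambda>x y. h' y *\<^sub>C x)"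
    using lin unfolding cbilinear_def clinear_iff
    by (simp_all add: scaleC_add_left scaleC_add_right scaleC_scaleC scaleC_complex_def mult.commute)
  have "h' (slice_left h t) = h (slice_right h' t)" for t
    unfolding slice_left_def slice_right_def
  proof (induction t rule: tensor_induct)
    case (elem x y)
    show ?case
      using lin unfolding tensor_lift_elem[OF bl] tensor_lift_elem[OF br] clinear_iff
      by (simp add: scaleC_complex_def)
  next
    case (add s t)
    then show ?case
      by (simp only: complex_vector.linear_add[OF lin(1)] complex_vector.linear_add[OF lin(2)]
          complex_vector.linear_add[OF tensor_lift_clinear[OF bl]]
          complex_vector.linear_add[OF tensor_lift_clinear[OF br]])
  qed
  from this[of "\<Delta> a"] show "h a = h' a"
    using h h' lin one unfolding is_haar_state_def clinear_iff by (simp add: scaleC_complex_def)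
qed

lemma haar_state_eq: "is_haar_state \<Delta> h \<Longrightarrow> haar_state \<Delta> = h"
  unfolding haar_state_def by (blast intro: the_equality is_haar_state_unique)

section \<open>Finitely generated discrete quantum groups\<close>

definition adjoint_matrix :: "'a::complex_star_algebra^'n^'m \<Rightarrow> 'a^'m^'n"
  where "adjoint_matrix u = (\<chi> i j. star (u $ j $ i))"

definition conj_matrix :: "'a::complex_star_algebra^'n^'m \<Rightarrow> 'a^'n^'m"
  where "conj_matrix u = (\<chi> i j. star (u $ i $ j))"

definition unitary_matrix :: "'a::complex_star_algebra^'n^'n \<Rightarrow> bool"
  where "unitary_matrix u \<longleftrightarrow> u ** adjoint_matrix u = mat 1 \<and> adjoint_matrix u ** u = mat 1"

definition star_subalgebra :: "'a::complex_star_algebra set \<Rightarrow> bool" where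
  "star_subalgebra B \<longleftrightarrow> complex_vector.subspace B \<and> 1 \<in> B
     \<and> (\<forall>x\<in>B. \<forall>y\<in>B. x * y \<in> B) \<and> (\<forall>x\<in>B. star x \<in> B)"

definition compact_matrix_quantum_group ::
    "('a::complex_star_algebra \<Rightarrow> ('a, 'a) tensor) \<Rightarrow> 'a^'n^'n \<Rightarrow> bool" where
  "compact_matrix_quantum_group \<Delta> u \<longleftrightarrow>
     compact_quantum_group \<Delta>
     \<and> unitary_matrix u
     \<and> (\<forall>i j. \<Delta> (u $ i $ j) = (\<Sum>k\<in>UNIV. u $ i $ k \<otimes> u $ k $ j))
     \<and> star_subalgebra hull {u $ i $ j | i j. True} = UNIV
     \<and> invertible (conj_matrix u)"

text \<open>
  A finitely generated discrete quantum group is the Pontryagin dual of a compact matrix quantum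
  group and is represented by the data \<open>(\<Delta>, u)\<close> of the latter. A quotient map runs from the
  algebra of \<open>v\<close> to the algebra of \<open>u\<close>.
\<close>

abbreviation fg_discrete_quantum_group ::
    "('a::complex_star_algebra \<Rightarrow> ('a, 'a) tensor) \<Rightarrow> 'a^'n^'n \<Rightarrow> bool"
  where "fg_discrete_quantum_group \<equiv> compact_matrix_quantum_group"

definition is_quotient_of ::
    "'a::complex_star_algebra^'n^'n \<Rightarrow> 'b::complex_star_algebra^'n^'n \<Rightarrow> bool" where
  "is_quotient_of u v \<longleftrightarrow>
     (\<exists>\<phi> :: 'b \<Rightarrow> 'a. star_hom \<phi> \<and> (\<forall>i j. \<phi> (v $ i $ j) = u $ i $ j))"

definition is_isomorphic_to ::
    "'a::complex_star_algebra^'n^'n \<Rightarrow> 'b::complex_star_algebra^'n^'n \<Rightarrow> bool" where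
  "is_isomorphic_to u v \<longleftrightarrow>
     (\<exists>\<phi> :: 'b \<Rightarrow> 'a. star_hom \<phi> \<and> bij \<phi> \<and> (\<forall>i j. \<phi> (v $ i $ j) = u $ i $ j))"

definition main_character :: "'a::complex_star_algebra^'n^'n \<Rightarrow> 'a"
  where "main_character u = trace u"

text \<open>
  Moments are real, but are kept as complex numbers: \<open>z \<le> w\<close> on \<^typ>\<open>complex\<close> means that \<open>w - z\<close> is
  a nonnegative real number.
\<close>

definition moment ::
    "('a::complex_star_algebra \<Rightarrow> ('a, 'a) tensor) \<Rightarrow> 'a^'n^'n \<Rightarrow> nat \<Rightarrow> complex" where
  "moment \<Delta> u k = haar_state \<Delta> ((main_character u + star (main_character u)) ^ k)"

end

theory Submission
  imports Defs
begin

text \<open>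
  Let \<open>w\<close> be the \<open>k\<close>-th tensor power of \<open>v \<oplus> v\<^sup>c\<close>, so that its trace is \<open>(\<chi> + \<chi>\<^sup>*)\<^sup>k\<close>. The invariance of
  the Haar states makes the complex matrices \<open>P\<^sub>1 = h\<^sub>1(\<phi>(w))\<close> and \<open>P\<^sub>2 = h\<^sub>2(w)\<close> idempotents with
  \<open>P\<^sub>1 P\<^sub>2 = P\<^sub>2 P\<^sub>1 = P\<^sub>2\<close>. Hence \<open>P\<^sub>1 - P\<^sub>2\<close> is idempotent, and the difference of the \<open>k\<close>-th moments
  is its trace, a natural number that vanishes only if \<open>P\<^sub>1 = P\<^sub>2\<close>. If all moments agree, then
  \<open>h\<^sub>1 \<circ> \<phi> = h\<^sub>2\<close>, because the entries of all the \<open>w\<close> span the algebra; since \<open>h\<^sub>2\<close> is faithful,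
  \<open>\<phi>\<close> is injective.
\<close>

section \<open>Linear maps, slices and tensor products\<close>

lemma clinear_simps:
  assumes "clinear f"
  shows "f (x + y) = f x + f y" "f (c *\<^sub>C x) = c *\<^sub>C f x" "f 0 = 0" "f (x - y) = f x - f y"
    "f (sum g A) = (\<Sum>a\<in>A. f (g a))"
  using assms complex_vector.linear_0[OF assms] complex_vector.linear_diff[OF assms]
    complex_vector.linear_sum[OF assms] by (auto simp: clinear_iff)

lemma star_0 [simp]: "star (0::'a::complex_star_algebra) = 0"
  using star_add[of "0::'a" 0] by simp

lemma star_1 [simp]: "star (1::'a::complex_star_algebra) = 1"
  by (metis mult_1_right mult_1_left star_mult star_star)

lemma star_sum: "star (sum f A) = (\<Sum>a\<in>A. star (f a :: 'a::complex_star_algebra))"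
  by (induction A rule: infinite_finite_induct) (simp_all add: star_add)

lemma slice_left_simps:
  assumes "clinear f"
  shows "slice_left f (x \<otimes> y) = f x *\<^sub>C y" "clinear (slice_left f)"
proof -
  have "cbilinear (\<lambda>x y. f x *\<^sub>C y)"
    by (simp add: cbilinear_def clinear_iff clinear_simps[OF assms] scaleC_add_left
        scaleC_add_right scaleC_scaleC scaleC_complex_def mult.commute)
  from tensor_lift[OF this] show "slice_left f (x \<otimes> y) = f x *\<^sub>C y" "clinear (slice_left f)"
    by (simp_all add: slice_left_def)
qed

lemma slice_right_simps:
  assumes "clinear f"
  shows "slice_right f (x \<otimes> y) = f y *\<^sub>C x" "clinear (slice_right f)"
proof -
  have "cbilinear (\<lambda>x y. f y *\<^sub>C x)"
    by (simp add: cbilinear_def clinear_iff clinear_simps[OF assms] scaleC_add_left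
        scaleC_add_right scaleC_scaleC scaleC_complex_def mult.commute)
  from tensor_lift[OF this] show "slice_right f (x \<otimes> y) = f y *\<^sub>C x" "clinear (slice_right f)"
    by (simp_all add: slice_right_def)
qed

lemma tensor_map_simps:
  assumes "clinear f" "clinear g"
  shows "tensor_map f g (x \<otimes> y) = f x \<otimes> g y" "clinear (tensor_map f g)"
proof -
  have "cbilinear (\<lambda>x y. f x \<otimes> g y)"
    using assms by (simp add: cbilinear_def clinear_iff tensor_elem_simps)
  from tensor_lift[OF this]
  show "tensor_map f g (x \<otimes> y) = f x \<otimes> g y" "clinear (tensor_map f g)"
    by (simp_all add: tensor_map_def)
qed

lemma clinear_id: "clinear id"
  by (simp add: clinear_iff)

lemma clinear_functional_separates:
  fixes x :: "'a::complex_vector"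
  assumes "x \<noteq> 0"
  obtains f :: "'a \<Rightarrow> complex" where "clinear f" "f x \<noteq> 0"
proof -
  have "complex_vector.independent {x}"
    using assms by (simp add: complex_vector.dependent_single)
  from complex_vector.linear_independent_extend[OF this, of "\<lambda>_. 1::complex"]
  obtain f :: "'a \<Rightarrow> complex" where "clinear f" "f x = 1" by auto
  with that show thesis by simp
qed

lemma tensor_elem_sum_left: "sum f A \<otimes> y = (\<Sum>a\<in>A. f a \<otimes> y)"
proof -
  have "clinear (\<lambda>x. x \<otimes> y)" by (simp add: clinear_iff tensor_elem_simps)
  from complex_vector.linear_sum[OF this] show ?thesis .
qed

text \<open>The first leg is expanded in a basis: \<open>E\<close> collects the basis vectors that
  occur and the \<open>\<beta> e\<close> are coordinate functionals. This turns information about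
  all left slices of \<open>t\<close> into information about \<open>t\<close> itself.\<close>

lemma tensor_sum_slices:
  fixes t :: "('a::complex_vector, 'b::complex_vector) tensor"
  shows "\<exists>E \<beta>. finite E \<and> (\<forall>e\<in>E. clinear (\<beta> e)) \<and> t = (\<Sum>e\<in>E. e \<otimes> slice_left (\<beta> e) t)"
proof -
  obtain B :: "'a set" where B: "complex_vector.independent B" "complex_vector.span B = UNIV"
    by (rule complex_vector.maximal_independent_subset[of UNIV]) auto
  define \<beta> where "\<beta> e x = complex_vector.representation B x e" for e x
  have \<beta>: "clinear (\<beta> e)" for e
    unfolding clinear_iff \<beta>_def
    using complex_vector.representation_add[OF B(1)] complex_vector.representation_scale[OF B(1)]
    by (simp add: B(2) scaleC_complex_def)
  note sl = slice_left_simps(1)[OF \<beta>] clinear_simps[OF slice_left_simps(2)[OF \<beta>]]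
  \<comment> \<open>The expansion is claimed over every finite superset of \<open>E\<close>, so that
    the expansions of two summands can both be written over the union of their sets.\<close>
  have "\<exists>E. finite E \<and> (\<forall>F. finite F \<and> E \<subseteq> F \<longrightarrow> t = (\<Sum>e\<in>F. e \<otimes> slice_left (\<beta> e) t))"
  proof (induction t rule: tensor_induct)
    case (elem x y)
    let ?E = "{e. complex_vector.representation B x e \<noteq> 0}"
    have fin: "finite ?E" by (rule complex_vector.finite_representation)
    have "x \<otimes> y = (\<Sum>e\<in>F. e \<otimes> slice_left (\<beta> e) (x \<otimes> y))" if "finite F" "?E \<subseteq> F" for F
    proof -
      have "x = (\<Sum>e\<in>?E. \<beta> e x *\<^sub>C e)"
        using complex_vector.sum_nonzero_representation_eq[OF B(1), of x]
        by (simp add: B(2) \<beta>_def)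
      also have "\<dots> = (\<Sum>e\<in>F. \<beta> e x *\<^sub>C e)"
        using that by (intro sum.mono_neutral_left) (auto simp: \<beta>_def)
      finally have "x \<otimes> y = (\<Sum>e\<in>F. \<beta> e x *\<^sub>C e) \<otimes> y" by simp
      also have "\<dots> = (\<Sum>e\<in>F. e \<otimes> slice_left (\<beta> e) (x \<otimes> y))"
        unfolding tensor_elem_sum_left sl(1) tensor_elem_simps(3,4) ..
      finally show ?thesis .
    qed
    with fin show ?case by blast
  next
    case (add s t)
    obtain E where E: "finite E"
      "\<forall>F. finite F \<and> E \<subseteq> F \<longrightarrow> s = (\<Sum>e\<in>F. e \<otimes> slice_left (\<beta> e) s)"
      using add.IH(1) by (elim exE conjE)
    obtain E' where E': "finite E'"
      "\<forall>F. finite F \<and> E' \<subseteq> F \<longrightarrow> t = (\<Sum>e\<in>F. e \<otimes> slice_left (\<beta> e) t)"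
      using add.IH(2) by (elim exE conjE)
    have st: "s + t = (\<Sum>e\<in>F. e \<otimes> slice_left (\<beta> e) (s + t))"
      if F: "finite F" "E \<union> E' \<subseteq> F" for F
    proof -
      have "s = (\<Sum>e\<in>F. e \<otimes> slice_left (\<beta> e) s)"
        using F E(2)[rule_format, of F] by simp
      moreover have "t = (\<Sum>e\<in>F. e \<otimes> slice_left (\<beta> e) t)"
        using F E'(2)[rule_format, of F] by simp
      ultimately have "s + t
        = (\<Sum>e\<in>F. e \<otimes> slice_left (\<beta> e) s) + (\<Sum>e\<in>F. e \<otimes> slice_left (\<beta> e) t)"
        by (rule arg_cong2)
      then show ?thesis unfolding sl(2) tensor_elem_simps sum.distrib .
    qed
    show ?case
    proof (intro exI conjI allI impI)
      show "finite (E \<union> E')" using E(1) E'(1) by simp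
    qed (use st in blast)
  qed
  with \<beta> show ?thesis by blast
qed

section \<open>Faithfulness of the Haar state\<close>

text \<open>Since \<open>h (star x * x) = 0\<close>, the nonnegative value of \<open>h\<close> at
  \<open>star (c *\<^sub>C x + z) * (c *\<^sub>C x + z)\<close> has no quadratic term in
  \<open>c\<close>; its linear terms must then vanish.\<close>

lemma positive_functional_null:
  fixes h :: "'a::complex_star_algebra \<Rightarrow> complex"
  assumes h: "clinear h" and pos: "\<And>a. 0 \<le> h (star a * a)" and x: "h (star x * x) = 0"
  shows "h (y * x) = 0"
proof -
  define z where "z = star y"
  define p q where "p = h (star x * z)" and "q = h (star z * x)"
  have *: "0 \<le> cnj c * p + c * q + h (star z * z)" for c
  proof -
    have "h (star (c *\<^sub>C x + z) * (c *\<^sub>C x + z)) = cnj c * p + c * q + h (star z * z)"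
      using x by (simp add: star_add star_scaleC distrib_left distrib_right mult_scaleC_left
          mult_scaleC_right clinear_simps[OF h] p_def q_def scaleC_complex_def)
    with pos[of "c *\<^sub>C x + z"] show ?thesis by simp
  qed
  have z: "Im (h (star z * z)) = 0" using pos[of z] by (simp add: less_eq_complex_def)
  \<comment> \<open>At \<open>c = 1\<close> and \<open>c = \<i>\<close> the imaginary part vanishes,
    which gives \<open>Im p + Im q = 0\<close> and \<open>Re q = Re p\<close>.\<close>
  have pq: "p = cnj q"
    using *[of 1] *[of \<i>] z by (auto simp: complex_eq_iff less_eq_complex_def)
  have "q = 0"
  proof (rule ccontr)
    assume "q \<noteq> 0"
    define s where "s = Re (h (star z * z))"
    \<comment> \<open>This scaling makes \<open>c * q\<close> the real number
      \<open>- (s + 1)\<close>, so the nonnegative expression becomes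
      \<open>- 2 * (s + 1) + s\<close>, which is negative.\<close>
    define c where "c = - of_real ((s + 1) / (cmod q)\<^sup>2) * cnj q"
    have "c * q = - of_real (s + 1)"
      using \<open>q \<noteq> 0\<close> complex_norm_square[of q] by (simp add: c_def mult.assoc mult.commute[of "cnj q"])
    moreover from this have "cnj c * p = - of_real (s + 1)"
      unfolding pq by (metis complex_cnj_mult complex_cnj_minus complex_cnj_complex_of_real)
    ultimately have "0 \<le> - 2 * (s + 1) + s"
      using *[of c] by (simp add: less_eq_complex_def s_def)
    moreover have "s \<ge> 0" using pos[of z] by (simp add: less_eq_complex_def s_def)
    ultimately show False by simp
  qed
  then show ?thesis by (simp add: q_def z_def star_star)
qed

text \<open>
  In Sweedler notation, \<open>x\<^sub>1 h(y x\<^sub>2) = S(y\<^sub>1) y\<^sub>2 x\<^sub>1 h(y\<^sub>3 x\<^sub>2) = S(y\<^sub>1) h(y\<^sub>2 x)\<close>.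
\<close>

lemma strong_left_invariance:
  fixes \<Delta> :: "'a::complex_star_algebra \<Rightarrow> ('a, 'a) tensor"
  assumes \<Delta>: "star_hom \<Delta>"
    and coassoc: "\<And>a. tensor_assoc (tensor_map \<Delta> id (\<Delta> a)) = tensor_map id \<Delta> (\<Delta> a)"
    and \<epsilon>: "is_counit \<Delta> \<epsilon>" and S: "is_antipode \<Delta> \<epsilon> S"
    and h: "clinear h" "\<And>a. slice_right h (\<Delta> a) = h a *\<^sub>C 1"
  shows "slice_right h ((1 \<otimes> y) * \<Delta> x) = tensor_lift (\<lambda>a b. h (b * x) *\<^sub>C S a) (\<Delta> y)"
proof -
  have \<Delta>lin: "clinear \<Delta>" and \<Delta>mult: "\<And>a b. \<Delta> (a * b) = \<Delta> a * \<Delta> b"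
    using \<Delta> by (auto simp: star_hom_def)
  have Slin: "clinear S" and \<epsilon>lin: "clinear \<epsilon>" using S \<epsilon> by (auto simp: is_antipode_def is_counit_def)
  note hs = slice_right_simps(1)[OF h(1)] clinear_simps[OF slice_right_simps(2)[OF h(1)]]
  note alg = distrib_left distrib_right mult_scaleC_left mult_scaleC_right tensor_mult_elem
    tensor_elem_simps
  \<comment> \<open>In Sweedler notation \<open>M c\<close> is
    \<open>x\<^sub>1 h(c x\<^sub>2)\<close>; below, \<open>P\<close> sends
    \<open>b \<otimes> c\<close> to \<open>b x\<^sub>1 h(c x\<^sub>2)\<close> and \<open>G\<close>
    sends \<open>a \<otimes> (b \<otimes> c)\<close> to
    \<open>S(a) b x\<^sub>1 h(c x\<^sub>2)\<close>. The claim follows by evaluating \<open>G\<close>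
    on both sides of coassociativity at \<open>y\<close>.\<close>
  define M where "M c = slice_right h ((1 \<otimes> c) * \<Delta> x)" for c
  have M: "clinear M" unfolding clinear_iff M_def by (simp add: alg hs)
  have bmul: "cbilinear ((*) :: 'a \<Rightarrow> _)" by (simp add: cbilinear_def clinear_iff alg)
  have bP: "cbilinear (\<lambda>b c. b * M c)"
    by (simp add: cbilinear_def clinear_iff alg clinear_simps[OF M])
  define P where "P = tensor_lift (\<lambda>b c. b * M c)"
  note P = tensor_lift[OF bP, folded P_def]
  have bG: "cbilinear (\<lambda>a s. S a * P s)"
    by (simp add: cbilinear_def clinear_iff alg clinear_simps[OF P(2)] clinear_simps[OF Slin])
  define G where "G = tensor_lift (\<lambda>a s. S a * P s)"
  note G = tensor_lift[OF bG, folded G_def]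
  have slice_mult: "slice_right h ((b \<otimes> 1) * t) = b * slice_right h t" for b :: 'a and t
    by (induction t rule: tensor_induct) (simp_all add: alg hs)
  have P_eq: "P s = slice_right h (s * \<Delta> x)" for s
  proof (induction s rule: tensor_induct)
    case (elem b c)
    have "slice_right h ((b \<otimes> c) * \<Delta> x) = slice_right h ((b \<otimes> 1) * ((1 \<otimes> c) * \<Delta> x))"
      by (simp add: tensor_mult_elem flip: mult.assoc)
    then show ?case by (simp only: P(1) M_def slice_mult)
  qed (simp add: clinear_simps[OF P(2)] alg hs)
  have bR: "cbilinear (\<lambda>a b. h (b * x) *\<^sub>C S a)"
    by (simp add: cbilinear_def clinear_iff alg clinear_simps[OF h(1)] clinear_simps[OF Slin]
        scaleC_add_left scaleC_add_right scaleC_scaleC scaleC_complex_def mult.commute)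
  note R = tensor_lift[OF bR]
  note idD = tensor_map_simps[OF clinear_id \<Delta>lin]
  note Did = tensor_map_simps[OF \<Delta>lin clinear_id]
  note Sid = tensor_map_simps[OF Slin clinear_id]
  \<comment> \<open>Multiplicativity makes \<open>P (\<Delta> b)\<close> the slice of
    \<open>\<Delta> (b * x)\<close>, which invariance evaluates.\<close>
  have 1: "G (tensor_map id \<Delta> t) = tensor_lift (\<lambda>a b. h (b * x) *\<^sub>C S a) t" for t
  proof (induction t rule: tensor_induct)
    case (elem a b)
    have "P (\<Delta> b) = h (b * x) *\<^sub>C 1" by (simp add: P_eq flip: \<Delta>mult h(2))
    then have "G (a \<otimes> \<Delta> b) = h (b * x) *\<^sub>C S a"
      by (simp only: G(1) mult_scaleC_right mult_1_right)
    moreover have "tensor_map id \<Delta> (a \<otimes> b) = a \<otimes> \<Delta> b"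
      using idD(1)[of a b] by (simp only: id_apply)
    ultimately show ?case by (simp only: R(1))
  qed (simp only: clinear_simps(1)[OF idD(2)] clinear_simps(1)[OF G(2)] clinear_simps(1)[OF R(2)])
  have bA: "cbilinear (\<lambda>x y. x \<otimes> (y \<otimes> z))" for z :: 'a
    by (simp add: cbilinear_def clinear_iff tensor_elem_simps)
  note A = tensor_lift[OF bA]
  have bA': "cbilinear (\<lambda>s z. tensor_lift (\<lambda>x y. x \<otimes> (y \<otimes> z)) s
      :: ('a, ('a, 'a) tensor) tensor)"
    unfolding cbilinear_def
  proof (intro conjI allI)
    show "clinear (\<lambda>z. tensor_lift (\<lambda>x y. x \<otimes> (y \<otimes> z)) s :: ('a, ('a, 'a) tensor) tensor)" for s
      unfolding clinear_iff
    proof (intro conjI allI)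
      fix z z' :: 'a and c
      show "tensor_lift (\<lambda>x y. x \<otimes> (y \<otimes> (z + z'))) s
        = tensor_lift (\<lambda>x y. x \<otimes> (y \<otimes> z)) s + tensor_lift (\<lambda>x y. x \<otimes> (y \<otimes> z')) s"
        by (induction s rule: tensor_induct)
          ((simp only: A(1) clinear_simps[OF A(2)])?, simp add: tensor_elem_simps)+
      show "tensor_lift (\<lambda>x y. x \<otimes> (y \<otimes> (c *\<^sub>C z))) s
        = c *\<^sub>C tensor_lift (\<lambda>x y. x \<otimes> (y \<otimes> z)) s"
        by (induction s rule: tensor_induct)
          ((simp only: A(1) clinear_simps[OF A(2)])?,
            simp add: tensor_elem_simps scaleC_add_right)+
    qed
  qed (rule A(2))
  note TA = tensor_lift[OF bA', folded tensor_assoc_def]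
  note mul = tensor_lift[OF bmul]
  have 2: "G (tensor_assoc (s \<otimes> b)) = tensor_lift (*) (tensor_map S id s) * M b" for s b
    by (induction s rule: tensor_induct)
      (simp_all only: TA(1) clinear_simps(1)[OF TA(2)] A(1) clinear_simps(1)[OF A(2)] G(1)
        clinear_simps(1)[OF G(2)] P(1) Sid(1) clinear_simps(1)[OF Sid(2)] mul(1)
        clinear_simps(1)[OF mul(2)] distrib_right mult.assoc, simp)
  \<comment> \<open>With \<open>s = \<Delta> a\<close> in the previous fact, the antipode axiom
    collapses the left factor to the scalar \<open>\<epsilon> a\<close>, which moves into
    \<open>M\<close>. At \<open>t = \<Delta> y\<close> the counit then leaves
    \<open>M y\<close>.\<close>
  have 3: "G (tensor_assoc (tensor_map \<Delta> id t)) = M (slice_left \<epsilon> t)" for t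
  proof (induction t rule: tensor_induct)
    case (elem a b)
    have "tensor_lift (*) (tensor_map S id (\<Delta> a)) = \<epsilon> a *\<^sub>C 1"
      using S by (auto simp: is_antipode_def)
    then have "G (tensor_assoc (\<Delta> a \<otimes> b)) = M (slice_left \<epsilon> (a \<otimes> b))"
      by (simp add: 2 slice_left_simps(1)[OF \<epsilon>lin] mult_scaleC_left clinear_simps(2)[OF M])
    moreover have "tensor_map \<Delta> id (a \<otimes> b) = \<Delta> a \<otimes> b"
      using Did(1)[of a b] by (simp only: id_apply)
    ultimately show ?case by (simp only:)
  qed (simp only: clinear_simps(1)[OF Did(2)] clinear_simps(1)[OF G(2)] clinear_simps(1)[OF TA(2)]
      clinear_simps(1)[OF M] clinear_simps(1)[OF slice_left_simps(2)[OF \<epsilon>lin]])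
  have "M y = M (slice_left \<epsilon> (\<Delta> y))" using \<epsilon> by (simp add: is_counit_def)
  also have "\<dots> = G (tensor_map id \<Delta> (\<Delta> y))" by (simp add: coassoc flip: 3)
  finally show ?thesis by (simp add: 1 M_def)
qed

text \<open>
  By Cauchy-Schwarz, \<open>h(x\<^sup>* x) = 0\<close> puts \<open>x\<close> into \<open>N = {x. \<forall>y. h(y x) = 0}\<close>. Strong left invariance
  gives \<open>\<Delta>(N) \<subseteq> A \<otimes> N\<close>, so that \<open>\<epsilon>(x) = h(S(x\<^sub>1) x\<^sub>2) = 0\<close> on \<open>N\<close> and \<open>x = x\<^sub>1 \<epsilon>(x\<^sub>2) = 0\<close>.
\<close>

theorem haar_state_faithful:
  fixes \<Delta> :: "'a::complex_star_algebra \<Rightarrow> ('a, 'a) tensor"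
  assumes "hopf_star_algebra \<Delta>" and haar: "is_haar_state \<Delta> h" and "h (star x * x) = 0"
  shows "x = 0"
proof -
  obtain \<epsilon> S where \<epsilon>: "is_counit \<Delta> \<epsilon>" and S: "is_antipode \<Delta> \<epsilon> S"
    and \<Delta>: "star_hom \<Delta>"
    and coassoc: "\<And>a. tensor_assoc (tensor_map \<Delta> id (\<Delta> a)) = tensor_map id \<Delta> (\<Delta> a)"
    using assms by (auto simp: hopf_star_algebra_def)
  have h: "clinear h" "\<And>a. slice_right h (\<Delta> a) = h a *\<^sub>C 1" "\<And>a. 0 \<le> h (star a * a)" "h 1 = 1"
    using haar by (auto simp: is_haar_state_def)
  have Slin: "clinear S" and \<epsilon>lin: "clinear \<epsilon>" using S \<epsilon> by (auto simp: is_antipode_def is_counit_def)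
  note Sid = tensor_map_simps[OF Slin clinear_id]
  have bmul: "cbilinear ((*) :: 'a \<Rightarrow> _)"
    by (simp add: cbilinear_def clinear_iff distrib_left distrib_right mult_scaleC_left
        mult_scaleC_right)
  note mul = tensor_lift[OF bmul]
  define N where "N = {x. \<forall>y. h (y * x) = 0}"
  \<comment> \<open>This is \<open>\<Delta>(N) \<subseteq> A \<otimes> N\<close> expressed through
    slices. As \<open>f\<close> acts on the first leg and \<open>h\<close> on the second, they can
    be applied in either order, with strong left invariance used on the \<open>h\<close>
    side.\<close>
  have slice_N: "slice_left f (\<Delta> x) \<in> N" if x: "x \<in> N" and f: "clinear f" for f x
    unfolding N_def
  proof (intro CollectI allI)
    fix y
    note fs = slice_left_simps(1)[OF f] clinear_simps[OF slice_left_simps(2)[OF f]]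
    note hs = slice_right_simps(1)[OF h(1)] clinear_simps[OF slice_right_simps(2)[OF h(1)]]
    have "h (y * slice_left f t) = f (slice_right h ((1 \<otimes> y) * t))" for t
      by (induction t rule: tensor_induct)
        (simp_all add: fs hs tensor_mult_elem distrib_left mult_scaleC_right clinear_simps[OF h(1)]
          clinear_simps[OF f] scaleC_complex_def)
    also have "slice_right h ((1 \<otimes> y) * \<Delta> x) = tensor_lift (\<lambda>a b. h (b * x) *\<^sub>C S a) (\<Delta> y)"
      by (rule strong_left_invariance[OF \<Delta> coassoc \<epsilon> S h(1,2)])
    \<comment> \<open>The bilinear map itself is zero here because \<open>x \<in> N\<close>, so the
      sum defining its lift vanishes term by term.\<close>
    also have "\<dots> = 0"
      using x by (simp add: N_def tensor_lift_def tensor_semilift_def)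
    finally show "h (y * slice_left f (\<Delta> x)) = 0" by (simp add: clinear_simps[OF f])
  qed
  have \<epsilon>_N: "\<epsilon> x = 0" if x: "x \<in> N" for x
  proof -
    \<comment> \<open>All second legs of this expansion lie in \<open>N\<close>, which absorbs left
      multiplication by \<open>S e\<close> under \<open>h\<close>.\<close>
    obtain E \<beta> where E: "\<forall>e\<in>E. clinear (\<beta> e)" "\<Delta> x = (\<Sum>e\<in>E. e \<otimes> slice_left (\<beta> e) (\<Delta> x))"
      using tensor_sum_slices by blast
    have "\<epsilon> x = h (\<epsilon> x *\<^sub>C 1)" by (simp add: clinear_simps[OF h(1)] h(4) scaleC_complex_def)
    also have "\<epsilon> x *\<^sub>C 1 = tensor_lift (*) (tensor_map S id (\<Delta> x))"
      using S by (auto simp: is_antipode_def)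
    also have "\<dots> = (\<Sum>e\<in>E. S e * slice_left (\<beta> e) (\<Delta> x))"
      by (subst E(2)) (simp add: Sid(1) clinear_simps[OF Sid(2)] mul(1) clinear_simps[OF mul(2)])
    also have "h \<dots> = 0"
      using slice_N[OF x] E(1) by (simp add: clinear_simps[OF h(1)] N_def)
    finally show ?thesis .
  qed
  have x: "x \<in> N"
    using positive_functional_null[OF h(1,3) assms(3)] by (simp add: N_def)
  show "x = 0"
  proof (rule ccontr)
    assume "x \<noteq> 0"
    then obtain f :: "'a \<Rightarrow> complex" where f: "clinear f" "f x \<noteq> 0"
      using clinear_functional_separates by blast
    \<comment> \<open>The identity \<open>x = x\<^sub>1 \<epsilon>(x\<^sub>2)\<close> is tested
      against \<open>f\<close>, since this puts a slice of \<open>\<Delta> x\<close>, an element of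
      \<open>N\<close>, under \<epsilon>.\<close>
    have "\<epsilon> (slice_left f t) = f (slice_right \<epsilon> t)" for t
      by (induction t rule: tensor_induct)
        (simp_all add: slice_left_simps(1)[OF f(1)] slice_right_simps(1)[OF \<epsilon>lin]
          clinear_simps[OF slice_left_simps(2)[OF f(1)]]
          clinear_simps[OF slice_right_simps(2)[OF \<epsilon>lin]]
          clinear_simps[OF f(1)] clinear_simps[OF \<epsilon>lin] scaleC_complex_def)
    from this[of "\<Delta> x"] have "f x = 0"
      using \<epsilon> \<epsilon>_N[OF slice_N[OF x f(1)]] by (simp add: is_counit_def)
    with f show False by simp
  qed
qed

section \<open>Traces of idempotent matrices\<close>

text \<open>
  If \<open>Q i j \<noteq> 0\<close>, subtracting the rank one idempotent \<open>Q e\<^sub>j e\<^sub>i\<^sup>T Q / Q i j\<close> lowers the trace by one,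
  kills row \<open>i\<close>, and keeps the zero rows zero.
\<close>

lemma idempotent_trace:
  fixes Q :: "'i \<Rightarrow> 'i \<Rightarrow> 'a::field"
  assumes "finite I" and "\<And>i j. i \<in> I \<Longrightarrow> j \<in> I \<Longrightarrow> (\<Sum>k\<in>I. Q i k * Q k j) = Q i j"
  shows "\<exists>n. (\<Sum>i\<in>I. Q i i) = of_nat n \<and> (n = 0 \<longrightarrow> (\<forall>i\<in>I. \<forall>j\<in>I. Q i j = 0))"
  using assms(2)
proof (induction "card {i\<in>I. \<exists>j\<in>I. Q i j \<noteq> 0}" arbitrary: Q rule: less_induct)
  case less
  note idem = less.prems
  show ?case
  proof (cases "\<forall>i\<in>I. \<forall>j\<in>I. Q i j = 0")
    case True
    then show ?thesis by (intro exI[of _ 0]) simp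
  next
    case False
    then obtain i j where ij: "i \<in> I" "j \<in> I" "Q i j \<noteq> 0" by blast
    define R where "R k l = Q k j * Q i l / Q i j" for k l
    define Q' where "Q' k l = Q k l - R k l" for k l
    have QR: "(\<Sum>m\<in>I. Q k m * R m l) = R k l" if "k \<in> I" for k l
      using idem[OF that ij(2)] by (simp add: R_def mult.assoc flip: sum_distrib_right sum_divide_distrib)
        (simp flip: mult.assoc sum_distrib_right)
    have RQ: "(\<Sum>m\<in>I. R k m * Q m l) = R k l" if "l \<in> I" for k l
      using idem[OF ij(1) that] by (simp add: R_def mult.assoc flip: sum_distrib_left sum_divide_distrib)
    have RR: "(\<Sum>m\<in>I. R k m * R m l) = R k l" for k l
    proof -
      have "(\<Sum>m\<in>I. R k m * R m l) = Q k j / Q i j * (\<Sum>m\<in>I. Q i m * Q m j) * Q i l / Q i j"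
        by (simp add: R_def sum_distrib_left sum_distrib_right sum_divide_distrib mult_ac)
      then show ?thesis using idem[OF ij(1,2)] ij(3) by (simp add: R_def)
    qed
    have trR: "(\<Sum>k\<in>I. R k k) = 1"
      using idem[OF ij(1,2)] ij(3) by (simp add: R_def mult.commute flip: sum_divide_distrib)
    have "card {i\<in>I. \<exists>j\<in>I. Q' i j \<noteq> 0} < card {i\<in>I. \<exists>j\<in>I. Q i j \<noteq> 0}"
    proof (rule psubset_card_mono)
      have "Q' k l = 0" if "\<forall>l\<in>I. Q k l = 0" "l \<in> I" for k l
        using that ij by (simp add: Q'_def R_def)
      moreover have "Q' i l = 0" for l using ij by (simp add: Q'_def R_def)
      ultimately show "{i\<in>I. \<exists>j\<in>I. Q' i j \<noteq> 0} \<subset> {i\<in>I. \<exists>j\<in>I. Q i j \<noteq> 0}"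
        using ij by blast
    qed (use assms(1) in simp)
    moreover have "(\<Sum>m\<in>I. Q' k m * Q' m l) = Q' k l" if "k \<in> I" "l \<in> I" for k l
      using that by (simp add: Q'_def left_diff_distrib right_diff_distrib sum_subtractf
          idem QR RQ RR)
    ultimately obtain n where "(\<Sum>i\<in>I. Q' i i) = of_nat n"
      using less.hyps[of Q'] by blast
    \<comment> \<open>As \<open>R\<close> has trace one, the witness for \<open>Q\<close> is a
      successor and the clause about \<open>n = 0\<close> holds vacuously.\<close>
    then have "(\<Sum>i\<in>I. Q i i) = of_nat (Suc n)"
      using trR by (simp add: Q'_def sum_subtractf algebra_simps)
    then show ?thesis by (intro exI[of _ "Suc n"]) simp
  qed
qed

section \<open>Tensor powers of \<open>u \<oplus> u\<^sup>c\<close>\<close>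

text \<open>On words of length \<open>k\<close> this is the \<open>k\<close>-th tensor power of
  \<open>V\<close>, with words as multi-indices. \<open>map2\<close> truncates to the shorter word,
  hence the equal-length assumptions below.\<close>

definition word_matrix :: "('m \<Rightarrow> 'm \<Rightarrow> 'a::monoid_mult) \<Rightarrow> 'm list \<Rightarrow> 'm list \<Rightarrow> 'a"
  where "word_matrix V xs ys = prod_list (map2 V xs ys)"

lemma word_matrix_simps [simp]:
  "word_matrix V [] [] = 1" "word_matrix V (a # xs) (b # ys) = V a b * word_matrix V xs ys"
  by (simp_all add: word_matrix_def)

lemma word_matrix_append:
  "length xs = length ys \<Longrightarrow>
    word_matrix V (xs @ xs') (ys @ ys') = word_matrix V xs ys * word_matrix V xs' ys'"
  by (simp add: word_matrix_def)

lemma finite_words: "finite {xs :: 'm::finite list. length xs = k}"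
  using finite_lists_length_eq[of "UNIV :: 'm set" k] by simp

lemma sum_words_Suc:
  fixes f :: "'m::finite list \<Rightarrow> 'a::comm_monoid_add"
  shows "(\<Sum>xs | length xs = Suc k. f xs) = (\<Sum>a\<in>UNIV. \<Sum>xs | length xs = k. f (a # xs))"
proof -
  have "{xs :: 'm list. length xs = Suc k} = (\<lambda>(a, xs). a # xs) ` (UNIV \<times> {xs. length xs = k})"
    by (auto simp: length_Suc_conv image_iff)
  moreover have "inj_on (\<lambda>(a, xs). a # xs) (UNIV \<times> {xs :: 'm list. length xs = k})"
    by (auto simp: inj_on_def)
  ultimately show ?thesis
    by (simp add: sum.reindex sum.cartesian_product case_prod_unfold)
qed

text \<open>Traces are multiplicative on tensor products; this is how powers of the character, and
  hence moments, become traces.\<close>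

lemma trace_word_matrix:
  fixes V :: "'m::finite \<Rightarrow> 'm \<Rightarrow> 'a::semiring_1"
  shows "(\<Sum>xs | length xs = k. word_matrix V xs xs) = (\<Sum>a\<in>UNIV. V a a) ^ k"
  by (induction k) (simp_all add: sum_words_Suc sum_distrib_right flip: sum_distrib_left)

text \<open>Multiplicativity of \<Delta> and the legwise product of tensors make tensor powers of a
  corepresentation into corepresentations; a product of sums over letters is a sum over
  words.\<close>

lemma comult_word_matrix:
  fixes V :: "'m::finite \<Rightarrow> 'm \<Rightarrow> 'a::complex_star_algebra"
  assumes \<Delta>: "star_hom \<Delta>" and V: "\<And>a b. \<Delta> (V a b) = (\<Sum>c\<in>UNIV. V a c \<otimes> V c b)"
    and "length xs = length ys"
  shows "\<Delta> (word_matrix V xs ys)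
    = (\<Sum>zs | length zs = length xs. word_matrix V xs zs \<otimes> word_matrix V zs ys)"
  using assms(3)
proof (induction xs ys rule: list_induct2)
  case Nil
  have "\<Delta> 1 = 1 \<otimes> 1" using \<Delta> by (simp add: star_hom_def flip: one_tensor_def)
  then show ?case by simp
next
  case (Cons a xs b ys)
  have "\<Delta> (word_matrix V (a # xs) (b # ys)) = \<Delta> (V a b) * \<Delta> (word_matrix V xs ys)"
    using \<Delta> by (simp add: star_hom_def)
  then show ?case
    by (simp add: V Cons.IH sum_words_Suc sum_product tensor_mult_elem)
qed

lemma star_hom_word_matrix:
  assumes "star_hom \<phi>" and "length xs = length ys"
  shows "\<phi> (word_matrix V xs ys) = word_matrix (\<lambda>a b. \<phi> (V a b)) xs ys"
  using assms(2,1) by (induction xs ys rule: list_induct2) (simp_all add: star_hom_def)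

text \<open>The block diagonal matrix \<open>u \<oplus> u\<^sup>c\<close>; the Boolean in an index
  names the block, \<open>True\<close> being that of \<open>u\<^sup>c\<close>.\<close>

definition double_matrix ::
    "'a::complex_star_algebra^'n^'n \<Rightarrow> 'n \<times> bool \<Rightarrow> 'n \<times> bool \<Rightarrow> 'a" where
  "double_matrix u a b =
     (if snd a = snd b then if snd a then star (u $ fst a $ fst b) else u $ fst a $ fst b else 0)"

lemma sum_UNIV_prod_bool:
  fixes f :: "'n::finite \<times> bool \<Rightarrow> 'a::comm_monoid_add"
  shows "(\<Sum>a\<in>UNIV. f a) = (\<Sum>i\<in>UNIV. f (i, False)) + (\<Sum>i\<in>UNIV. f (i, True))"
proof -
  have "(\<Sum>a\<in>UNIV. f a) = (\<Sum>i\<in>UNIV. \<Sum>b\<in>UNIV. f (i, b))"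
    by (simp add: sum.cartesian_product)
  then show ?thesis by (simp add: UNIV_bool sum.distrib)
qed

lemma trace_double_matrix:
  "(\<Sum>a\<in>UNIV. double_matrix u a a) = main_character u + star (main_character u)"
  by (simp add: sum_UNIV_prod_bool double_matrix_def main_character_def trace_def star_sum)

text \<open>\<Delta> commutes with the involution, so \<open>u\<^sup>c\<close> is a corepresentation
  along with \<open>u\<close>, and terms across the blocks vanish.\<close>

lemma comult_double_matrix:
  assumes \<Delta>: "star_hom \<Delta>" and u: "\<And>i j. \<Delta> (u $ i $ j) = (\<Sum>k\<in>UNIV. u $ i $ k \<otimes> u $ k $ j)"
  shows "\<Delta> (double_matrix u a b) = (\<Sum>c\<in>UNIV. double_matrix u a c \<otimes> double_matrix u c b)"
proof -
  have [simp]: "(0::'a) \<otimes> y = 0" "y \<otimes> (0::'a) = 0" for y :: 'a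
    using tensor_elem_simps(3)[of 0 0 y] tensor_elem_simps(4)[of y 0 0] by simp_all
  have "\<Delta> 0 = 0" using \<Delta> by (simp add: star_hom_def clinear_simps)
  moreover have "\<Delta> (star x) = star (\<Delta> x)" for x using \<Delta> by (simp add: star_hom_def)
  ultimately show ?thesis
    by (cases "snd a"; cases "snd b")
      (simp_all add: double_matrix_def sum_UNIV_prod_bool u star_sum star_tensor_simps)
qed

text \<open>The involution reverses products and exchanges the blocks, so it permutes the entries of
  the tensor powers.\<close>

lemma star_word_double_matrix:
  fixes u :: "'a::complex_star_algebra^'n^'n"
  defines "flip \<equiv> map_prod (\<lambda>i. i) Not"
  assumes "length xs = length ys"
  shows "star (word_matrix (double_matrix u) xs ys)
    = word_matrix (double_matrix u) (rev (map flip xs)) (rev (map flip ys))"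
  using assms(2)
proof (induction xs ys rule: list_induct2)
  case (Cons a xs b ys)
  have "star (double_matrix u a b) = double_matrix u (flip a) (flip b)"
    by (cases a; cases b) (auto simp: double_matrix_def flip_def star_star)
  with Cons show ?case by (simp add: star_mult word_matrix_append)
qed simp

text \<open>The span is a unital star subalgebra containing the generators: concatenated words give
  products, flipped reversed words give adjoints, and the empty word gives the unit.\<close>

lemma span_word_double_matrix:
  fixes u :: "'a::complex_star_algebra^'n^'n"
  assumes gen: "star_subalgebra hull {u $ i $ j | i j. True} = UNIV"
  shows "complex_vector.span
    {word_matrix (double_matrix u) xs ys | xs ys. length xs = length ys} = UNIV"
    (is "complex_vector.span ?W = UNIV")
proof -
  let ?B = "complex_vector.span ?W"
  \<comment> \<open>Closure under products is reduced to words by linearity, first in the right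
    factor and then in the left.\<close>
  have left: "w * y \<in> ?B" if w: "w \<in> ?W" and y: "y \<in> ?B" for w y
    using y
  proof (induction rule: complex_vector.span_induct)
    case base
    show ?case
      by (rule complex_vector.subspaceI)
        (auto simp: distrib_left mult_scaleC_right complex_vector.span_zero
          intro: complex_vector.span_add complex_vector.span_scale)
  next
    case (step y)
    from step w obtain xs ys xs' ys' where
      "w = word_matrix (double_matrix u) xs ys" "length xs = length ys"
      "y = word_matrix (double_matrix u) xs' ys'" "length xs' = length ys'" by blast
    then have "w * y = word_matrix (double_matrix u) (xs @ xs') (ys @ ys')"
      "length (xs @ xs') = length (ys @ ys')"
      by (simp_all add: word_matrix_append)
    then show ?case by (intro complex_vector.span_base) blast
  qed
  have mult: "x * y \<in> ?B" if x: "x \<in> ?B" and y: "y \<in> ?B" for x y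
    using x
  proof (induction rule: complex_vector.span_induct)
    case base
    show ?case
      by (rule complex_vector.subspaceI)
        (auto simp: distrib_right mult_scaleC_left complex_vector.span_zero
          intro: complex_vector.span_add complex_vector.span_scale)
  qed (rule left[OF _ y])
  have star: "star x \<in> ?B" if x: "x \<in> ?B" for x
    using x
  proof (induction rule: complex_vector.span_induct)
    case base
    show ?case
      by (rule complex_vector.subspaceI)
        (auto simp: star_add star_scaleC complex_vector.span_zero
          intro: complex_vector.span_add complex_vector.span_scale)
  next
    case (step x)
    then obtain xs ys where "x = word_matrix (double_matrix u) xs ys" "length xs = length ys"
      by blast
    then show ?case
      by (intro complex_vector.span_base) (force simp: star_word_double_matrix)
  qed
  have one: "1 \<in> ?B"
    by (intro complex_vector.span_base CollectI exI[of _ "[]"]) simp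
  have "star_subalgebra ?B"
    using mult star one by (simp add: star_subalgebra_def)
  moreover have "{u $ i $ j | i j. True} \<subseteq> ?B"
  proof clarify
    fix i j
    have "u $ i $ j = word_matrix (double_matrix u) [(i, False)] [(j, False)]
        \<and> length [(i, False)] = length [(j, False)]"
      by (simp add: double_matrix_def)
    then have "u $ i $ j \<in> ?W" by blast
    then show "u $ i $ j \<in> ?B" by (rule complex_vector.span_base)
  qed
  ultimately have "star_subalgebra hull {u $ i $ j | i j. True} \<subseteq> ?B"
    by (intro hull_minimal)
  with gen show ?thesis by blast
qed

section \<open>The quotient map and the comparison of moments\<close>

lemma star_subalgebra_range:
  assumes "star_hom \<phi>"
  shows "star_subalgebra (range \<phi>)"
proof -
  have lin: "clinear \<phi>" and mult: "\<And>x y. \<phi> x * \<phi> y = \<phi> (x * y)" and one: "\<phi> 1 = 1"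
    and star: "\<And>x. star (\<phi> x) = \<phi> (star x)"
    using assms by (auto simp: star_hom_def)
  show ?thesis
    unfolding star_subalgebra_def
    using complex_vector.linear_subspace_image[OF lin complex_vector.subspace_UNIV]
    by (auto simp: mult star) (metis one rangeI)
qed

theorem theorem3p4:
  fixes \<Delta>\<^sub>1 :: "'a::complex_star_algebra \<Rightarrow> ('a, 'a) tensor" and u :: "'a^'n^'n"
    and \<Delta>\<^sub>2 :: "'b::complex_star_algebra \<Rightarrow> ('b, 'b) tensor" and v :: "'b^'n^'n"
  assumes "fg_discrete_quantum_group \<Delta>\<^sub>1 u"
    and "fg_discrete_quantum_group \<Delta>\<^sub>2 v"
    and "is_quotient_of u v"
  shows "(\<forall>k. moment \<Delta>\<^sub>2 v k \<le> moment \<Delta>\<^sub>1 u k) \<and>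
    ((\<forall>k. moment \<Delta>\<^sub>2 v k = moment \<Delta>\<^sub>1 u k) \<longrightarrow> is_isomorphic_to u v)"
proof -
  obtain h\<^sub>1 h\<^sub>2 where haar: "is_haar_state \<Delta>\<^sub>1 h\<^sub>1" "is_haar_state \<Delta>\<^sub>2 h\<^sub>2"
    and hopf: "hopf_star_algebra \<Delta>\<^sub>2"
    and \<Delta>: "star_hom \<Delta>\<^sub>1" "star_hom \<Delta>\<^sub>2"
    and corep: "\<And>i j. \<Delta>\<^sub>1 (u $ i $ j) = (\<Sum>k\<in>UNIV. u $ i $ k \<otimes> u $ k $ j)"
      "\<And>i j. \<Delta>\<^sub>2 (v $ i $ j) = (\<Sum>k\<in>UNIV. v $ i $ k \<otimes> v $ k $ j)"
    and gen: "star_subalgebra hull {u $ i $ j | i j. True} = UNIV"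
      "star_subalgebra hull {v $ i $ j | i j. True} = UNIV"
    using assms(1,2) unfolding compact_matrix_quantum_group_def compact_quantum_group_def
      hopf_star_algebra_def by blast
  obtain \<phi> :: "'b \<Rightarrow> 'a" where \<phi>: "star_hom \<phi>" and \<phi>v: "\<And>i j. \<phi> (v $ i $ j) = u $ i $ j"
    using assms(3) by (auto simp: is_quotient_of_def)
  have \<phi>lin: "clinear \<phi>" using \<phi> by (simp add: star_hom_def)
  have h1: "clinear h\<^sub>1" "h\<^sub>1 1 = 1" "\<And>a. slice_left h\<^sub>1 (\<Delta>\<^sub>1 a) = h\<^sub>1 a *\<^sub>C 1"
    and h2: "clinear h\<^sub>2" "h\<^sub>2 1 = 1" "\<And>a. slice_left h\<^sub>2 (\<Delta>\<^sub>2 a) = h\<^sub>2 a *\<^sub>C 1"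
      "\<And>a. slice_right h\<^sub>2 (\<Delta>\<^sub>2 a) = h\<^sub>2 a *\<^sub>C 1"
    using haar by (auto simp: is_haar_state_def)
  define W where "W = word_matrix (double_matrix v)"
  define U where "U = word_matrix (double_matrix u)"
  \<comment> \<open>Pulling \<open>h\<^sub>1\<close> back along \<phi> puts both functionals on the
    algebra of \<open>v\<close>: for words of length \<open>k\<close>,
    \<open>\<psi> (W xs ys)\<close> and \<open>h\<^sub>2 (W xs ys)\<close> are the entries of
    \<open>P\<^sub>1\<close> and \<open>P\<^sub>2\<close>.\<close>
  define \<psi> where "\<psi> x = h\<^sub>1 (\<phi> x)" for x
  have \<psi>: "clinear \<psi>" "\<psi> 1 = 1"
    using \<phi> h1 by (auto simp: \<psi>_def clinear_iff star_hom_def)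
  have \<phi>V: "(\<lambda>a b. \<phi> (double_matrix v a b)) = double_matrix u"
    using \<phi> clinear_simps(3)[OF \<phi>lin] by (auto simp: double_matrix_def \<phi>v star_hom_def fun_eq_iff)
  have \<phi>W: "\<phi> (W xs ys) = U xs ys" if "length xs = length ys" for xs ys
    using star_hom_word_matrix[OF \<phi> that] by (simp add: W_def U_def \<phi>V)
  note comult = comult_word_matrix[OF \<Delta>(1) comult_double_matrix[OF \<Delta>(1) corep(1)], folded U_def]
    comult_word_matrix[OF \<Delta>(2) comult_double_matrix[OF \<Delta>(2) corep(2)], folded W_def]
  \<comment> \<open>Slicing the comultiplication of the entries gives three matrix identities:
    \<open>P\<^sub>1 U = P\<^sub>1\<close>, \<open>P\<^sub>2 W = P\<^sub>2\<close> and
    \<open>W P\<^sub>2 = P\<^sub>2\<close>.\<close>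
  have inv1: "(\<Sum>zs | length zs = length xs. \<psi> (W xs zs) *\<^sub>C U zs ys) = \<psi> (W xs ys) *\<^sub>C 1"
    if "length xs = length ys" for xs ys
    using h1(3)[of "U xs ys"] that
    by (simp add: comult slice_left_simps(1)[OF h1(1)] clinear_simps[OF slice_left_simps(2)[OF h1(1)]]
        \<psi>_def \<phi>W)
  have inv2l: "(\<Sum>zs | length zs = length xs. h\<^sub>2 (W xs zs) *\<^sub>C W zs ys) = h\<^sub>2 (W xs ys) *\<^sub>C 1"
    if "length xs = length ys" for xs ys
    using h2(3)[of "W xs ys"] that
    by (simp add: comult slice_left_simps(1)[OF h2(1)] clinear_simps[OF slice_left_simps(2)[OF h2(1)]])
  have inv2r: "(\<Sum>zs | length zs = length xs. h\<^sub>2 (W zs ys) *\<^sub>C W xs zs) = h\<^sub>2 (W xs ys) *\<^sub>C 1"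
    if "length xs = length ys" for xs ys
    using h2(4)[of "W xs ys"] that
    by (simp add: comult slice_right_simps(1)[OF h2(1)] clinear_simps[OF slice_right_simps(2)[OF h2(1)]])
  \<comment> \<open>Applying \<open>h\<^sub>1\<close>, \<psi> or \<open>h\<^sub>2\<close> to the
    entries of these identities turns \<open>U\<close> and \<open>W\<close> into
    \<open>P\<^sub>1\<close> or \<open>P\<^sub>2\<close>.\<close>
  have P11: "(\<Sum>zs | length zs = length xs. \<psi> (W xs zs) * \<psi> (W zs ys)) = \<psi> (W xs ys)"
    if "length xs = length ys" for xs ys
    using arg_cong[OF inv1[OF that], of h\<^sub>1] that
    by (simp add: clinear_simps[OF h1(1)] h1(2) scaleC_complex_def \<psi>_def \<phi>W)
  have P21: "(\<Sum>zs | length zs = length xs. h\<^sub>2 (W xs zs) * \<psi> (W zs ys)) = h\<^sub>2 (W xs ys)"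
    if "length xs = length ys" for xs ys
    using arg_cong[OF inv2l[OF that], of \<psi>]
    by (simp add: clinear_simps[OF \<psi>(1)] \<psi>(2) scaleC_complex_def)
  have P12: "(\<Sum>zs | length zs = length xs. \<psi> (W xs zs) * h\<^sub>2 (W zs ys)) = h\<^sub>2 (W xs ys)"
    if "length xs = length ys" for xs ys
    using arg_cong[OF inv2r[OF that], of \<psi>]
    by (simp add: clinear_simps[OF \<psi>(1)] \<psi>(2) scaleC_complex_def mult.commute)
  have P22: "(\<Sum>zs | length zs = length xs. h\<^sub>2 (W xs zs) * h\<^sub>2 (W zs ys)) = h\<^sub>2 (W xs ys)"
    if "length xs = length ys" for xs ys
    using arg_cong[OF inv2l[OF that], of h\<^sub>2]
    by (simp add: clinear_simps[OF h2(1)] h2(2) scaleC_complex_def)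
  define Q where "Q xs ys = \<psi> (W xs ys) - h\<^sub>2 (W xs ys)" for xs ys
  \<comment> \<open>The square of \<open>P\<^sub>1 - P\<^sub>2\<close> is
    \<open>P\<^sub>1 - P\<^sub>2 - P\<^sub>2 + P\<^sub>2\<close>.\<close>
  have idem: "(\<Sum>zs | length zs = k. Q xs zs * Q zs ys) = Q xs ys"
    if "length xs = k" "length ys = k" for k xs ys
    using that P11[of xs ys] P12[of xs ys] P21[of xs ys] P22[of xs ys]
    by (simp add: Q_def left_diff_distrib right_diff_distrib sum_subtractf)
  have moments: "moment \<Delta>\<^sub>1 u k - moment \<Delta>\<^sub>2 v k = (\<Sum>xs | length xs = k. Q xs xs)" for k
  proof -
    have "moment \<Delta>\<^sub>1 u k = (\<Sum>xs | length xs = k. h\<^sub>1 (U xs xs))"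
      by (simp add: moment_def haar_state_eq[OF haar(1)] U_def clinear_simps[OF h1(1), symmetric]
          trace_word_matrix trace_double_matrix)
    moreover have "moment \<Delta>\<^sub>2 v k = (\<Sum>xs | length xs = k. h\<^sub>2 (W xs xs))"
      by (simp add: moment_def haar_state_eq[OF haar(2)] W_def clinear_simps[OF h2(1), symmetric]
          trace_word_matrix trace_double_matrix)
    ultimately show ?thesis by (simp add: Q_def sum_subtractf \<psi>_def \<phi>W)
  qed
  have key: "\<exists>n. moment \<Delta>\<^sub>1 u k - moment \<Delta>\<^sub>2 v k = of_nat n \<and>
      (n = 0 \<longrightarrow> (\<forall>xs ys. length xs = k \<longrightarrow> length ys = k \<longrightarrow> Q xs ys = 0))" for k
    using idempotent_trace[OF finite_words[of k], of Q] idem unfolding moments by auto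
  have le: "moment \<Delta>\<^sub>2 v k \<le> moment \<Delta>\<^sub>1 u k" for k
  proof -
    obtain n where "moment \<Delta>\<^sub>1 u k - moment \<Delta>\<^sub>2 v k = of_nat n" using key by blast
    then have "moment \<Delta>\<^sub>1 u k = moment \<Delta>\<^sub>2 v k + of_nat n" by (simp add: algebra_simps)
    then show ?thesis by (simp add: less_eq_complex_def)
  qed
  have "is_isomorphic_to u v" if eq: "\<forall>k. moment \<Delta>\<^sub>2 v k = moment \<Delta>\<^sub>1 u k"
  proof -
    \<comment> \<open>Equal moments force \<open>n = 0\<close>, so the whole matrix \<open>Q\<close>
      vanishes at each length, including its off-diagonal entries.\<close>
    have words: "\<psi> (W xs ys) = h\<^sub>2 (W xs ys)" if "length xs = length ys" for xs ys
      using key[of "length xs"] eq that by (auto simp: Q_def)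
    have "\<psi> x = h\<^sub>2 x" for x
    proof -
      have "x \<in> complex_vector.span {W xs ys | xs ys. length xs = length ys}"
        using span_word_double_matrix[OF gen(2)] by (simp add: W_def)
      then show ?thesis
        by (rule complex_vector.linear_eq_on[OF \<psi>(1) h2(1)]) (use words in blast)
    qed
    \<comment> \<open>If \<open>\<phi> x = 0\<close>, then
      \<open>h\<^sub>2 (star x * x) = h\<^sub>1 (\<phi> (star x * x)) = 0\<close>, and faithfulness
      applies.\<close>
    then have "x = 0" if "\<phi> x = 0" for x
      using haar_state_faithful[OF hopf haar(2), of x] that \<phi> clinear_simps(3)[OF h1(1)]
      by (simp add: \<psi>_def star_hom_def flip: \<open>\<And>x. \<psi> x = h\<^sub>2 x\<close>)
    then have "inj \<phi>"
      by (simp add: complex_vector.linear_inj_iff_eq_0[OF \<phi>lin])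
    \<comment> \<open>The range of \<phi> is a star subalgebra containing the generators
      \<open>u $ i $ j\<close>, so \<phi> is surjective.\<close>
    have "star_subalgebra hull {u $ i $ j | i j. True} \<subseteq> range \<phi>"
    proof (intro hull_minimal star_subalgebra_range \<phi> subsetI)
      fix x assume "x \<in> {u $ i $ j | i j. True}"
      then obtain i j where "x = \<phi> (v $ i $ j)" using \<phi>v by auto
      then show "x \<in> range \<phi>" by simp
    qed
    then have "surj \<phi>" unfolding gen(1) by blast
    with \<open>inj \<phi>\<close> have "bij \<phi>" by (simp add: bij_def)
    with \<phi> \<phi>v show ?thesis unfolding is_isomorphic_to_def by blast
  qed
  with le show ?thesis by blast
qed

end
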